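(* Let $n\ge 5$ and let $B=(a,n-a)$ with $1\le a\le n-1$ ($a$ an integer). Then $$f_B(1,0)-f_B(1,1)=G(n,a)-D(n),$$ where $$D(n)=\frac{1}{n}\binom{2n-2}{n-1}\quad\text{and}\quad G(n,a)=\frac{n-2a+1}{n-a}\binom{n}{a}\binom{n-2}{a-1}.$$
   Context: For $n\in\mathbb{N}$, $\mathcal{G}(n)=\{(x,y)\in\mathbb{Z}^2: 0\le x\le n,\ 0\le y\le n\}$, and $\mathcal{P}_n$ is the set of lattice paths from $(0,0)$ to $(n,n)$ using only unit east steps $(1,0)$ and unit north steps $(0,1)$. For $A,B\in\mathcal{G}(n)$ with $B\notin\{(0,0),(n,n)\}$, $f_B(A)$ denotes the number of paths $p\in\mathcal{P}_n$ that pass through $A$ and do not pass through $B$; for $A=(x,y)$ one writes $f_B(x,y)$. *)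

theory Defs
  imports Complex_Main
begin

type_synonym point = "int \<times> int"

definition unit_step :: "point \<Rightarrow> point \<Rightarrow> bool" where
  "unit_step P Q \<longleftrightarrow> Q = (fst P + 1, snd P) \<or> Q = (fst P, snd P + 1)"

text \<open>A lattice path is the list of the points it visits, endpoints included, so a path
  passes through a point iff the point occurs in the list. The steps are monotone, so every
  path from the origin to \<open>(n, n)\<close> stays in the grid \<open>0 \<le> x, y \<le> n\<close>.\<close>

definition lattice_paths :: "nat \<Rightarrow> point list set" where
  "lattice_paths n =
     {p. p \<noteq> [] \<and> hd p = (0, 0) \<and> last p = (int n, int n) \<and> successively unit_step p}"

text \<open>\<open>paths_avoiding n B A\<close> is $f_B(A)$ for the grid of size \<open>n\<close>.\<close>

definition paths_avoiding :: "nat \<Rightarrow> point \<Rightarrow> point \<Rightarrow> nat" where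
  "paths_avoiding n B A = card {p \<in> lattice_paths n. A \<in> set p \<and> B \<notin> set p}"

definition D :: "nat \<Rightarrow> real" where
  "D n = 1 / real n * real ((2 * n - 2) choose (n - 1))"

definition G :: "nat \<Rightarrow> nat \<Rightarrow> real" where
  "G n a = (real n - 2 * real a + 1) / (real n - real a)
             * real (n choose a) * real ((n - 2) choose (a - 1))"

end

theory Submission
  imports Defs
begin

text \<open>A path through \<open>A\<close> that avoids \<open>B\<close> is a path from the origin to \<open>A\<close> followed by a path from
  \<open>A\<close> to \<open>(n, n)\<close>, both avoiding \<open>B\<close>. Each step raises the sum of the coordinates by one, so if \<open>B\<close>
  has a larger sum than \<open>A\<close>, only the second part can meet \<open>B\<close>; its avoiding paths are all paths minus
  those that split at \<open>B\<close> (lemma \<open>paths_avoiding_eq\<close>). Together with the binomial count of lattice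
  paths (lemma \<open>card_paths\<close>) this gives, for \<open>B = (a, n - a)\<close>,
  \[ f_B(1,0) = \binom{2n-1}{n-1} - \binom{n-1}{a-1}\binom{n}{a}, \qquad
     f_B(1,1) = 2\left(\binom{2n-2}{n-1} - \binom{n-2}{a-1}\binom{n}{a}\right). \]
  In the difference, the terms without \<open>a\<close> combine to minus a Catalan number, which is \<open>- D n\<close>,
  and the terms with \<open>a\<close> combine to \<open>G n a\<close>; both follow from the absorption identities
  for binomial coefficients.\<close>

section \<open>Paths between two points\<close>

text \<open>Carrying the set \<open>S\<close> of forbidden points lets one splitting lemma serve both for
  avoiding \<open>B\<close> (\<open>S = {B}\<close>) and for counting the paths through \<open>B\<close> (\<open>S = {}\<close>).\<close>

definition paths_outside :: "point set \<Rightarrow> point \<Rightarrow> point \<Rightarrow> point list set" where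
  "paths_outside S P Q =
     {p. p \<noteq> [] \<and> hd p = P \<and> last p = Q \<and> successively unit_step p \<and> set p \<inter> S = {}}"

abbreviation paths :: "point \<Rightarrow> point \<Rightarrow> point list set" where
  "paths \<equiv> paths_outside {}"

lemma unit_step_path_bounds:
  assumes "p \<noteq> []" "successively unit_step p" "X \<in> set p"
  shows "fst (hd p) \<le> fst X" "fst X \<le> fst (last p)"
    and "snd (hd p) \<le> snd X" "snd X \<le> snd (last p)"
proof -
  have "\<forall>X \<in> set p. fst (hd p) \<le> fst X \<and> fst X \<le> fst (last p)
      \<and> snd (hd p) \<le> snd X \<and> snd X \<le> snd (last p)"
    using assms(1,2)
  proof (induction p rule: list_nonempty_induct)
    case (cons x xs)
    then have step: "unit_step x (hd xs)" and xs: "successively unit_step xs"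
      by (auto simp: successively_Cons)
    have le_hd: "fst x \<le> fst (hd xs)" "snd x \<le> snd (hd xs)"
      using step by (auto simp: unit_step_def)
    have IH: "fst (hd xs) \<le> fst X \<and> fst X \<le> fst (last xs)
        \<and> snd (hd xs) \<le> snd X \<and> snd X \<le> snd (last xs)" if "X \<in> set xs" for X
      using cons.IH[OF xs] that by blast
    show ?case
    proof
      fix X
      assume "X \<in> set (x # xs)"
      then consider "X = x" | "X \<in> set xs"
        by auto
      then show "fst (hd (x # xs)) \<le> fst X \<and> fst X \<le> fst (last (x # xs))
          \<and> snd (hd (x # xs)) \<le> snd X \<and> snd X \<le> snd (last (x # xs))"
        using IH[of X] IH[of "hd xs"] le_hd cons.hyps by cases auto
    qed
  qed auto
  then show "fst (hd p) \<le> fst X" "fst X \<le> fst (last p)"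
    and "snd (hd p) \<le> snd X" "snd X \<le> snd (last p)"
    using assms(3) by auto
qed

lemma unit_step_path_length:
  assumes "p \<noteq> []" "successively unit_step p"
  shows "fst (last p) + snd (last p) = fst (hd p) + snd (hd p) + int (length p) - 1"
  using assms
proof (induction p rule: list_nonempty_induct)
  case (cons x xs)
  then show ?case
    by (auto simp: successively_Cons unit_step_def)
qed auto

lemma paths_outside_length:
  assumes "p \<in> paths_outside S P Q"
  shows "int (length p) = fst Q + snd Q - fst P - snd P + 1"
  using assms unit_step_path_length[of p] by (auto simp: paths_outside_def)

section \<open>Splitting a path at a point\<close>

text \<open>The cut is unique because all paths from \<open>P\<close> to \<open>A\<close> have the same length, so a
  concatenation determines its two parts.\<close>

lemma card_paths_outside_through:
  "card {p \<in> paths_outside S P Q. A \<in> set p}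
     = card (paths_outside S P A) * card (paths_outside S A Q)"
proof -
  let ?join = "\<lambda>(p, q). p @ tl q :: point list"
  have "inj_on ?join (paths_outside S P A \<times> paths_outside S A Q)"
  proof (rule inj_onI, clarify)
    fix p q p' q'
    assume p: "p \<in> paths_outside S P A" "p' \<in> paths_outside S P A"
      and q: "q \<in> paths_outside S A Q" "q' \<in> paths_outside S A Q"
      and eq: "p @ tl q = p' @ tl q'"
    have "length p = length p'"
      using paths_outside_length[OF p(1)] paths_outside_length[OF p(2)] by simp
    then have "p = p'" "tl q = tl q'"
      using eq by auto
    moreover have "q = A # tl q" "q' = A # tl q'"
      using q unfolding paths_outside_def by (cases q; cases q'; simp)+
    ultimately show "p = p' \<and> q = q'"
      by metis
  qed
  moreover have "?join ` (paths_outside S P A \<times> paths_outside S A Q)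
      = {p \<in> paths_outside S P Q. A \<in> set p}"
  proof (intro equalityI subsetI)
    fix r
    assume "r \<in> ?join ` (paths_outside S P A \<times> paths_outside S A Q)"
    then obtain p q where p: "p \<in> paths_outside S P A" and q: "q \<in> paths_outside S A Q"
      and r: "r = p @ tl q"
      by auto
    obtain t where t: "q = A # t"
      using q unfolding paths_outside_def by (cases q) auto
    have "last p \<in> set p"
      using p by (auto simp: paths_outside_def)
    then show "r \<in> {p \<in> paths_outside S P Q. A \<in> set p}"
      using p q unfolding r t
      by (auto simp: paths_outside_def successively_append_iff successively_Cons
          split: if_splits)
  next
    fix r
    assume r: "r \<in> {p \<in> paths_outside S P Q. A \<in> set p}"
    then obtain ys zs where split: "r = ys @ A # zs"
      by (auto dest: split_list)
    have "ys @ [A] \<in> paths_outside S P A" "A # zs \<in> paths_outside S A Q"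
      using r unfolding split
      by (auto simp: paths_outside_def successively_append_iff successively_Cons hd_append
          split: if_splits)
    then show "r \<in> ?join ` (paths_outside S P A \<times> paths_outside S A Q)"
      unfolding split by (intro image_eqI[of _ _ "(ys @ [A], A # zs)"]) auto
  qed
  ultimately have "bij_betw ?join (paths_outside S P A \<times> paths_outside S A Q)
      {p \<in> paths_outside S P Q. A \<in> set p}"
    by (simp add: bij_betw_def)
  from bij_betw_same_card[OF this] show ?thesis
    by (simp add: card_cartesian_product)
qed

section \<open>The number of paths\<close>

lemma paths_empty:
  assumes "fst Q < fst P \<or> snd Q < snd P"
  shows "paths P Q = {}"
proof -
  have False if "p \<in> paths P Q" for p
    using that assms unit_step_path_bounds[of p "hd p"] by (auto simp: paths_outside_def)
  then show ?thesis
    by blast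
qed

lemma paths_self: "paths P P = {[P]}"
proof -
  have "p = [P]" if "p \<in> paths P P" for p
  proof -
    have "length p = 1"
      using paths_outside_length[OF that] by simp
    then show ?thesis
      using that by (auto simp: paths_outside_def length_Suc_conv)
  qed
  then show ?thesis
    by (auto simp: paths_outside_def)
qed

lemma paths_first_step:
  assumes "P \<noteq> Q"
  shows "paths P Q = Cons P ` (paths (fst P + 1, snd P) Q \<union> paths (fst P, snd P + 1) Q)"
proof (intro equalityI subsetI)
  fix p
  assume p: "p \<in> paths P Q"
  then obtain q where q: "p = P # q" "q \<noteq> []"
    using assms by (cases p) (auto simp: paths_outside_def split: if_splits)
  then have "q \<in> paths (fst P + 1, snd P) Q \<union> paths (fst P, snd P + 1) Q"
    using p by (auto simp: paths_outside_def successively_Cons unit_step_def)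
  then show "p \<in> Cons P ` (paths (fst P + 1, snd P) Q \<union> paths (fst P, snd P + 1) Q)"
    using q by blast
qed (auto simp: paths_outside_def successively_Cons unit_step_def)

text \<open>Splitting by the first step turns the count into Pascal's rule. Finiteness belongs in the same
  induction because the cardinality of a union is additive only for finite sets. If \<open>i = 0\<close>
  an east step first contributes nothing, since no step leads back west; likewise for \<open>j = 0\<close> and
  a north step.\<close>

lemma finite_card_paths:
  "finite (paths (x, y) (x + int i, y + int j))
     \<and> card (paths (x, y) (x + int i, y + int j)) = (i + j) choose i"
proof (induction "i + j" arbitrary: x y i j)
  case 0
  then show ?case
    by (simp add: paths_self)
next
  case (Suc k)
  let ?Q = "(x + int i, y + int j)"
  let ?E = "paths (x + 1, y) ?Q" and ?N = "paths (x, y + 1) ?Q"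
  have ne: "(x, y) \<noteq> ?Q"
    using Suc.hyps(2) by auto
  have E: "finite ?E \<and> card ?E = (case i of 0 \<Rightarrow> 0 | Suc i' \<Rightarrow> (i' + j) choose i')"
  proof (cases i)
    case (Suc i')
    then show ?thesis
      using Suc.hyps(1)[of i' j "x + 1" y] Suc.hyps(2) by (simp add: add.assoc)
  qed (simp add: paths_empty)
  have N: "finite ?N \<and> card ?N = (case j of 0 \<Rightarrow> 0 | Suc j' \<Rightarrow> (i + j') choose i)"
  proof (cases j)
    case (Suc j')
    then show ?thesis
      using Suc.hyps(1)[of i j' x "y + 1"] Suc.hyps(2) by (simp add: add.assoc)
  qed (simp add: paths_empty)
  have "?E \<inter> ?N = {}"
    by (auto simp: paths_outside_def)
  then have "card (paths (x, y) ?Q) = card ?E + card ?N"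
    using E N paths_first_step[OF ne] by (simp add: card_image card_Un_disjoint)
  moreover have "finite (paths (x, y) ?Q)"
    using E N paths_first_step[OF ne] by simp
  ultimately show ?case
    using E N Suc.hyps(2) by (cases i; cases j) auto
qed

lemma card_paths:
  assumes "fst Q = fst P + int i" "snd Q = snd P + int j"
  shows "card (paths P Q) = (i + j) choose i"
  using assms finite_card_paths[of "fst P" "snd P" i j] by (cases P; cases Q) simp

lemma finite_paths: "finite (paths P Q)"
proof (cases "fst P \<le> fst Q \<and> snd P \<le> snd Q")
  case True
  then show ?thesis
    using finite_card_paths[of "fst P" "snd P" "nat (fst Q - fst P)" "nat (snd Q - snd P)"] by simp
next
  case False
  then have "fst Q < fst P \<or> snd Q < snd P"
    by auto
  then show ?thesis
    by (simp add: paths_empty)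
qed

section \<open>Avoiding one point\<close>

lemma card_paths_outside_singleton:
  "real (card (paths_outside {B} P Q))
     = real (card (paths P Q)) - real (card (paths P B)) * real (card (paths B Q))"
proof -
  let ?T = "{p \<in> paths P Q. B \<in> set p}"
  have "paths_outside {B} P Q = paths P Q - ?T"
    by (auto simp: paths_outside_def)
  moreover have "card (paths P Q - ?T) = card (paths P Q) - card ?T"
    using finite_paths by (intro card_Diff_subset) auto
  moreover have "card ?T \<le> card (paths P Q)"
    using finite_paths by (intro card_mono) auto
  ultimately show ?thesis
    by (simp add: card_paths_outside_through)
qed

text \<open>The hypothesis puts \<open>B\<close> beyond the antidiagonal of \<open>A\<close>, where no path ending in \<open>A\<close> can
  get. So the first factor counts all paths to \<open>A\<close>, and only the second one is corrected for \<open>B\<close>.\<close>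

lemma paths_avoiding_eq:
  assumes "fst A + snd A < fst B + snd B"
  shows "real (paths_avoiding n B A) = real (card (paths (0, 0) A))
     * (real (card (paths A (int n, int n)))
         - real (card (paths A B)) * real (card (paths B (int n, int n))))"
proof -
  have "{p \<in> lattice_paths n. A \<in> set p \<and> B \<notin> set p}
      = {p \<in> paths_outside {B} (0, 0) (int n, int n). A \<in> set p}"
    unfolding lattice_paths_def paths_outside_def by blast
  moreover have "paths B A = {}"
    using assms by (intro paths_empty) linarith
  ultimately show ?thesis
    by (simp add: paths_avoiding_def card_paths_outside_through card_paths_outside_singleton)
qed

section \<open>Binomial identities\<close>

text \<open>\<open>D n\<close> is the Catalan number of index \<open>n - 1\<close>. By Pascal's rule the left side is
  $\binom{2n-2}{n} - \binom{2n-2}{n-1}$, the negative of the usual difference for that number.\<close>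

lemma binomial_difference_D:
  assumes "n \<ge> 1"
  shows "real ((2 * n - 1) choose (n - 1)) - 2 * real ((2 * n - 2) choose (n - 1)) = - D n"
proof -
  have arith: "2 * n - 1 - n = n - 1" "2 * n - 1 - 1 = 2 * n - 2" "n \<le> 2 * n - 1" "0 < n"
    using assms by linarith+
  have "(2 * n - 1) choose (n - 1) = (2 * n - 1) choose n"
    using binomial_symmetric[OF arith(3)] unfolding arith by (rule sym)
  moreover have "n * ((2 * n - 1) choose n) = (2 * n - 1) * ((2 * n - 2) choose (n - 1))"
    using times_binomial_minus1_eq[OF arith(4), of "2 * n - 1"] unfolding arith .
  then have "real n * real ((2 * n - 1) choose n)
      = real (2 * n - 1) * real ((2 * n - 2) choose (n - 1))"
    by (metis of_nat_mult)
  moreover have "real (2 * n - 1) = 2 * real n - 1"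
    using assms by simp
  ultimately have "n * real ((2 * n - 1) choose (n - 1))
      = (2 * real n - 1) * real ((2 * n - 2) choose (n - 1))"
    by simp
  then have "real ((2 * n - 1) choose (n - 1))
      = (2 * real n - 1) * real ((2 * n - 2) choose (n - 1)) / real n"
    using arith(4) by (simp only: eq_divide_eq mult.commute of_nat_eq_0_iff) simp
  moreover have "(2 * real n - 1) * c / real n - 2 * c = - (1 / real n * c)" for c
    using arith(4) by (simp add: divide_simps) (simp add: algebra_simps)
  ultimately show ?thesis
    unfolding D_def by simp
qed

text \<open>Absorption gives $\binom{n-1}{a-1} = \frac{n-1}{n-a}\binom{n-2}{a-1}$, and
  $2 - \frac{n-1}{n-a} = \frac{n-2a+1}{n-a}$ is the rational factor in \<open>G n a\<close>.\<close>

lemma binomial_difference_G: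
  assumes "1 \<le> a" "a < n"
  shows "(2 * real ((n - 2) choose (a - 1)) - real ((n - 1) choose (a - 1))) * real (n choose a)
    = G n a"
proof -
  have arith: "n - 1 - (a - 1) = n - a" "n - 1 - 1 = n - 2"
    using assms by linarith+
  have "(n - a) * ((n - 1) choose (a - 1)) = (n - 1) * ((n - 2) choose (a - 1))"
    using binomial_absorb_comp[of "n - 1" "a - 1"] unfolding arith .
  then have "real (n - a) * real ((n - 1) choose (a - 1))
      = real (n - 1) * real ((n - 2) choose (a - 1))"
    by (metis of_nat_mult)
  moreover have "real (n - a) = real n - real a" "real (n - 1) = real n - 1"
    using assms by auto
  moreover have pos: "real n - real a > 0"
    using assms by simp
  ultimately have "real ((n - 1) choose (a - 1))
      = (real n - 1) * real ((n - 2) choose (a - 1)) / (real n - real a)"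
    by (simp add: eq_divide_eq mult.commute)
  moreover have "2 * c - (real n - 1) * c / (real n - real a)
      = (real n - 2 * real a + 1) / (real n - real a) * c" for c
    using pos by (simp add: divide_simps) (simp add: algebra_simps)
  ultimately show ?thesis
    unfolding G_def by simp
qed

section \<open>The difference of the two counts\<close>

theorem proposition7p2:
  fixes n a :: nat and B :: point
  assumes "n \<ge> 5"
    and "1 \<le> a" and "a \<le> n - 1"
    and "B = (int a, int n - int a)"
  shows "real (paths_avoiding n B (1, 0)) - real (paths_avoiding n B (1, 1)) = G n a - D n"
proof -
  let ?Q = "(int n, int n)"
  have "a \<le> n"
    using assms by linarith
  have arith: "n - a + a = n" "n - 1 + n = 2 * n - 1" "a - 1 + (n - a) = n - 1"
    "n - 1 + (n - 1) = 2 * n - 2" "a - 1 + (n - a - 1) = n - 2"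
    using assms by linarith+
  have coords: "int (n - a) = int n - int a" "int (n - 1) = int n - 1" "int (a - 1) = int a - 1"
    "int (n - a - 1) = int n - int a - 1"
    using assms by linarith+
  have beyond: "2 < fst B + snd B"
    using assms by simp
  have "card (paths B ?Q) = (n - a + a) choose (n - a)"
    using assms coords by (intro card_paths) simp_all
  then have B: "card (paths B ?Q) = n choose a"
    unfolding arith using binomial_symmetric[OF \<open>a \<le> n\<close>] by simp
  have "card (paths (0, 0) (1, 0)) = (1 + 0) choose 1"
    "card (paths (1, 0) ?Q) = (n - 1 + n) choose (n - 1)"
    "card (paths (1, 0) B) = (a - 1 + (n - a)) choose (a - 1)"
    using assms coords by (intro card_paths; simp)+
  then have 1: "card (paths (0, 0) (1, 0)) = 1"
    "card (paths (1, 0) ?Q) = (2 * n - 1) choose (n - 1)"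
    "card (paths (1, 0) B) = (n - 1) choose (a - 1)"
    unfolding arith by simp_all
  have "card (paths (0, 0) (1, 1)) = (1 + 1) choose 1"
    "card (paths (1, 1) ?Q) = (n - 1 + (n - 1)) choose (n - 1)"
    "card (paths (1, 1) B) = (a - 1 + (n - a - 1)) choose (a - 1)"
    using assms coords by (intro card_paths; simp)+
  then have 2: "card (paths (0, 0) (1, 1)) = 2"
    "card (paths (1, 1) ?Q) = (2 * n - 2) choose (n - 1)"
    "card (paths (1, 1) B) = (n - 2) choose (a - 1)"
    unfolding arith by simp_all
  have f10: "real (paths_avoiding n B (1, 0))
      = real ((2 * n - 1) choose (n - 1)) - real ((n - 1) choose (a - 1)) * real (n choose a)"
    using paths_avoiding_eq[of "(1, 0)" B n] beyond by (simp add: B 1)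
  have f11: "real (paths_avoiding n B (1, 1))
      = 2 * (real ((2 * n - 2) choose (n - 1)) - real ((n - 2) choose (a - 1)) * real (n choose a))"
    using paths_avoiding_eq[of "(1, 1)" B n] beyond by (simp add: B 2)
  have D: "- D n = real ((2 * n - 1) choose (n - 1)) - 2 * real ((2 * n - 2) choose (n - 1))"
    using assms by (intro binomial_difference_D[symmetric]) linarith
  have G: "G n a
      = (2 * real ((n - 2) choose (a - 1)) - real ((n - 1) choose (a - 1))) * real (n choose a)"
    using assms by (intro binomial_difference_G[symmetric]; linarith)
  show ?thesis
    using D unfolding f10 f11 G by (simp only: algebra_simps)
qed

end
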